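(* All the coefficients $A_{n,m}$ of the polynomial $Q_n^{[2]}(z)=\sum_{k=0}^{n(n+1)/2}A_{n,k}z^{n(n+1)/2-k}$, $A_{n,0}=1$, can be obtained with the help of the first $n(n+1)/2+1$ coefficients of the expansion at infinity $w(z;\alpha)=\sum_{m=0}^{\infty}c_{\alpha,-(m+1)}z^{-m-1}$ for the solutions of $$w_{zzzz}-10w^2w_{zz}-10ww_z^2+6w^5-zw-\alpha=0.$$
   Context: The polynomials $Q_n^{[2]}(z)$ are the special polynomials associated with rational solutions of the fourth-order analogue of the second Painlevé equation, $w_{zzzz}-10w^2w_{zz}-10ww_z^2+6w^5-zw-\alpha=0$: each $Q_n^{[2]}$ is a monic polynomial of degree $n(n+1)/2$ (so $Q_0^{[2]}=1$), and for $n\ge1$ the function $w(z;n)=\frac{d}{dz}\ln\frac{Q^{[2]}_{n-1}(z)}{Q^{[2]}_n(z)}$ is a rational solution of this equation with $\alpha=n$. (The existence of these polynomials is taken as given.) Expansion at infinity: the solutions of the equation have the power expansion $w(z;\alpha)=\frac{c_{\alpha,-1}}{z}+\sum_{l=1}^{\infty}c_{\alpha,-5l-1}z^{-5l-1}$ as $z\to\infty$, whose coefficients depend on $\alpha$. It is also written $w(z;\alpha)=\sum_{m=0}^{\infty}c_{\alpha,-(m+1)}z^{-m-1}$, where $c_{\alpha,-(m+1)}=0$ unless $m$ is divisible by $5$; the coefficients are counted in this second form, starting from $m=0$. *)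

theory Defs
  imports "HOL-Analysis.Analysis" "HOL-Computational_Algebra.Computational_Algebra"
begin

definition P2_4_solution :: "complex set \<Rightarrow> complex \<Rightarrow> (complex \<Rightarrow> complex) \<Rightarrow> bool" where
  "P2_4_solution S \<alpha> w \<longleftrightarrow> (\<forall>z\<in>S.
     (deriv ^^ 4) w z - 10 * (w z)^2 * (deriv ^^ 2) w z - 10 * w z * (deriv w z)^2
       + 6 * (w z)^5 - z * w z - \<alpha> = 0)"

text \<open>
  The derivative of \<open>ln R\<close>, written as \<open>R' / R\<close> so as not to depend on a branch of the logarithm.
\<close>
definition dlog :: "(complex \<Rightarrow> complex) \<Rightarrow> complex \<Rightarrow> complex" where
  "dlog R z = deriv R z / R z"

definition rational_w :: "(nat \<Rightarrow> complex poly) \<Rightarrow> nat \<Rightarrow> complex \<Rightarrow> complex" where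
  "rational_w Q n = dlog (\<lambda>z. poly (Q (n - 1)) z / poly (Q n) z)"

text \<open>
  Power series in \<open>1/z\<close> are represented as formal power series in \<open>X = 1/z\<close>; the chain rule
  \<open>d/dz = - X\<^sup>2 d/dX\<close> gives the derivation below.
\<close>
definition fps_dz :: "complex fps \<Rightarrow> complex fps" where
  "fps_dz F = - (fps_X ^ 2 * fps_deriv F)"

text \<open>
  \<open>c m\<close> is the coefficient of \<open>z\<close> to the power \<open>-m-1\<close>, so that the expansion is
  \<open>W = X * Abs_fps c\<close>, and \<open>z w\<close> corresponds to \<open>W / X = Abs_fps c\<close>. That \<open>c m = 0\<close> unless
  \<open>5\<close> divides \<open>m\<close> is a consequence of the equation and is not imposed.
\<close>
definition expansion_at_infinity :: "complex \<Rightarrow> (nat \<Rightarrow> complex) \<Rightarrow> bool" where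
  "expansion_at_infinity \<alpha> c \<longleftrightarrow> (let W = fps_X * Abs_fps c in
     (fps_dz ^^ 4) W - 10 * W^2 * (fps_dz ^^ 2) W - 10 * W * (fps_dz W)^2
       + 6 * W^5 - Abs_fps c - fps_const \<alpha> = 0)"

text \<open>
  If \<open>d i m\<close> is the coefficient of \<open>z\<close> to the power \<open>-m-1\<close> in the expansion of \<open>w(z;i)\<close>, then
  \<open>power_sum_of d n m\<close> is the sum of the \<open>m\<close>-th powers of the roots of \<open>Q n\<close>, because
  \<open>w(z;i)\<close> is the logarithmic derivative of \<open>Q (i-1)\<close> minus that of \<open>Q i\<close> and \<open>Q 0 = 1\<close>.
\<close>
definition power_sum_of :: "(nat \<Rightarrow> nat \<Rightarrow> complex) \<Rightarrow> nat \<Rightarrow> nat \<Rightarrow> complex" where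
  "power_sum_of d n m = - (\<Sum>i=1..n. d i m)"

text \<open>
  Newton's identities \<open>m A\<^sub>m + s\<^sub>1 A\<^sub>m\<^sub>-\<^sub>1 + \<dots> + s\<^sub>m A\<^sub>0 = 0\<close>, \<open>A\<^sub>0 = 1\<close>, solved for the coefficients
  of a monic polynomial (counted from the top) in terms of the power sums \<open>s\<close> of its roots.
\<close>
fun newton_coeff :: "(nat \<Rightarrow> complex) \<Rightarrow> nat \<Rightarrow> complex" where
  "newton_coeff s 0 = 1"
| "newton_coeff s (Suc m) =
     - (\<Sum>l\<in>{1..Suc m}. s l * newton_coeff s (Suc m - l)) / of_nat (Suc m)"

end

theory Submission
  imports Defs "HOL-Complex_Analysis.Complex_Analysis"
begin

text \<open>
  In the coordinate \<open>x = 1/z\<close> the function \<open>w(z;n)\<close> is analytic at \<open>x = 0\<close>, so its Taylor series is a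
  formal solution of the equation at infinity. Modulo \<open>X\<^sup>k\<^sup>+\<^sup>1\<close>, every term of the equation other than
  \<open>z w\<close> and \<open>\<alpha>\<close> depends only on \<open>z w\<close> modulo \<open>X\<^sup>k\<close>, so the formal solution is
  unique. Hence the given coefficients are differences of the power sums of the roots of
  \<open>Q (n - 1)\<close> and \<open>Q n\<close>; summing over \<open>n\<close> telescopes, and Newton's identities recover \<open>Q n\<close>.
\<close>

section \<open>Uniqueness of the formal expansion at infinity\<close>

definition fps_lower_terms :: "complex fps \<Rightarrow> complex fps" where
  "fps_lower_terms W = (fps_dz ^^ 4) W - 10 * W^2 * (fps_dz ^^ 2) W - 10 * W * (fps_dz W)^2 + 6 * W^5"

text \<open>The factor \<open>fps_X ^ 2\<close> in the derivation makes up for the power lost by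
  differentiating: \<open>fps_dz (fps_X * H) = fps_X * (fps_dz H - fps_X * H)\<close>, and induction
  applies to \<open>H\<close>.\<close>

lemma fps_X_power_dvd_fps_dz: "fps_X ^ k dvd F \<Longrightarrow> fps_X ^ k dvd fps_dz F"
proof (induction k arbitrary: F)
  case (Suc k)
  then obtain H where H: "F = fps_X * H" "fps_X ^ k dvd H"
    by (metis dvd_def dvd_triv_left mult.assoc power_Suc)
  then have "fps_dz F = fps_X * (fps_dz H - fps_X * H)"
    by (simp add: fps_dz_def power2_eq_square algebra_simps)
  moreover have "fps_X ^ k dvd fps_dz H - fps_X * H"
    using Suc.IH[OF H(2)] H(2) by (intro dvd_diff dvd_mult)
  ultimately show ?case
    by (simp add: mult_dvd_mono)
qed simp

lemma fps_dz_diff: "fps_dz (F - G) = fps_dz F - fps_dz G"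
  by (simp add: fps_dz_def algebra_simps)

lemma fps_X_power_dvd_funpow_fps_dz_diff:
  assumes "fps_X ^ k dvd F - G"
  shows "fps_X ^ k dvd (fps_dz ^^ j) F - (fps_dz ^^ j) G"
  using assms by (induction j) (auto simp flip: fps_dz_diff intro: fps_X_power_dvd_fps_dz)

lemma dvd_mult_diff:
  fixes a b c d e :: "'a :: comm_ring_1"
  assumes "e dvd a - b" "e dvd c - d"
  shows "e dvd a * c - b * d"
proof -
  have "a * c - b * d = (a - b) * c + b * (c - d)"
    by (simp add: algebra_simps)
  then show ?thesis
    using assms by simp
qed

lemma dvd_power_diff:
  fixes a b e :: "'a :: comm_ring_1"
  assumes "e dvd a - b"
  shows "e dvd a ^ n - b ^ n"
  using assms by (induction n) (auto intro: dvd_mult_diff)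

text \<open>Congruence modulo \<open>fps_X ^ k\<close> is compatible with the derivation, products
  and powers, hence with each of the four terms.\<close>

lemma fps_X_power_dvd_fps_lower_terms_diff:
  assumes "fps_X ^ k dvd V - W"
  shows "fps_X ^ k dvd fps_lower_terms V - fps_lower_terms W"
proof -
  note D = fps_X_power_dvd_funpow_fps_dz_diff[OF assms]
  have D1: "fps_X ^ k dvd fps_dz V - fps_dz W"
    using D[of 1] by simp
  have "fps_X ^ k dvd 10 * V^2 * (fps_dz ^^ 2) V - 10 * W^2 * (fps_dz ^^ 2) W"
    by (intro dvd_mult_diff dvd_power_diff assms D) simp
  moreover have "fps_X ^ k dvd 10 * V * (fps_dz V)^2 - 10 * W * (fps_dz W)^2"
    by (intro dvd_mult_diff dvd_power_diff assms D1) simp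
  moreover have "fps_X ^ k dvd 6 * V^5 - 6 * W^5"
    by (intro dvd_mult_diff dvd_power_diff assms) simp
  ultimately have "fps_X ^ k dvd
      ((fps_dz ^^ 4) V - (fps_dz ^^ 4) W)
      - (10 * V^2 * (fps_dz ^^ 2) V - 10 * W^2 * (fps_dz ^^ 2) W)
      - (10 * V * (fps_dz V)^2 - 10 * W * (fps_dz W)^2)
      + (6 * V^5 - 6 * W^5)"
    using dvd_add[OF dvd_diff[OF dvd_diff[OF D[of 4]]]] by blast
  then show ?thesis
    by (simp add: fps_lower_terms_def algebra_simps)
qed

text \<open>Fixed-point form of the equation, suited to a contraction argument in the X-adic
  topology.\<close>

lemma expansion_at_infinity_iff:
  "expansion_at_infinity \<alpha> c \<longleftrightarrow>
     Abs_fps c = fps_lower_terms (fps_X * Abs_fps c) - fps_const \<alpha>"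
  by (auto simp: expansion_at_infinity_def fps_lower_terms_def Let_def algebra_simps)

lemma expansion_at_infinity_unique:
  assumes "expansion_at_infinity \<alpha> a" "expansion_at_infinity \<alpha> b"
  shows "a = b"
proof -
  let ?A = "Abs_fps a" and ?B = "Abs_fps b"
  have dvd: "fps_X ^ k dvd ?A - ?B" for k
  proof (induction k)
    case (Suc k)
    \<comment> \<open>The prefactor in \<open>W = fps_X * Abs_fps c\<close> raises the order of
      agreement by one, and the lower terms do not reduce it.\<close>
    then have "fps_X ^ Suc k dvd fps_X * ?A - fps_X * ?B"
      by (simp flip: right_diff_distrib)
    then have "fps_X ^ Suc k dvd fps_lower_terms (fps_X * ?A) - fps_lower_terms (fps_X * ?B)"
      by (rule fps_X_power_dvd_fps_lower_terms_diff)
    moreover have "?A - ?B = fps_lower_terms (fps_X * ?A) - fps_lower_terms (fps_X * ?B)"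
      using assms[unfolded expansion_at_infinity_iff] by (metis diff_diff_eq2 diff_add_cancel)
    ultimately show ?case
      by simp
  qed simp
  have "a m = b m" for m
  proof -
    obtain G where "?A - ?B = fps_X ^ Suc m * G"
      using dvd by blast
    then have "(?A - ?B) $ m = (fps_X ^ Suc m * G) $ m"
      by simp
    then show ?thesis
      by (simp add: fps_X_power_mult_nth del: power_Suc)
  qed
  then show ?thesis
    by blast
qed

section \<open>Change of variable from z to 1/z\<close>

text \<open>The operator \<open>d/dz\<close> in the coordinate \<open>x = 1/z\<close>.\<close>
definition inv_deriv :: "(complex \<Rightarrow> complex) \<Rightarrow> complex \<Rightarrow> complex" where
  "inv_deriv u x = - (x ^ 2 * deriv u x)"

lemma holomorphic_funpow_inv_deriv:
  assumes "u holomorphic_on S" "open S"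
  shows "(inv_deriv ^^ k) u holomorphic_on S"
proof (induction k)
  case (Suc k)
  then show ?case
    unfolding funpow.simps comp_def inv_deriv_def[abs_def] using assms(2)
    by (intro holomorphic_intros) auto
qed (use assms in simp)

lemma has_fps_expansion_funpow_inv_deriv:
  assumes "u has_fps_expansion U"
  shows "(inv_deriv ^^ k) u has_fps_expansion (fps_dz ^^ k) U"
proof (induction k)
  case (Suc k)
  then show ?case
    unfolding funpow.simps comp_def inv_deriv_def[abs_def] fps_dz_def
    by (intro fps_expansion_intros)
qed (use assms in simp)

lemma funpow_deriv_inverse:
  assumes hol: "u holomorphic_on S" and opn: "open S"
    and w: "\<And>z. z \<noteq> 0 \<Longrightarrow> inverse z \<in> S \<Longrightarrow> w z = u (inverse z)"
    and z: "z \<noteq> 0" "inverse z \<in> S"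
  shows "(deriv ^^ k) w z = (inv_deriv ^^ k) u (inverse z)"
  using z
proof (induction k arbitrary: z)
  case (Suc k)
  \<comment> \<open>Openness of this set makes the induction hypothesis hold on a neighbourhood of
    \<open>z\<close>, so that it may be differentiated.\<close>
  have "open (- {0} \<inter> (inverse :: complex \<Rightarrow> complex) -` S)"
    using assms(2) by (intro continuous_open_preimage continuous_intros) auto
  then have "eventually (\<lambda>y. y \<in> - {0} \<inter> inverse -` S) (nhds z)"
    using Suc.prems by (intro eventually_nhds_in_open) auto
  then have "eventually (\<lambda>y. (deriv ^^ k) w y = (inv_deriv ^^ k) u (inverse y)) (nhds z)"
    by eventually_elim (use Suc.IH in auto)
  then have "deriv ((deriv ^^ k) w) z = deriv (\<lambda>y. (inv_deriv ^^ k) u (inverse y)) z"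
    by (rule deriv_cong_ev) simp
  also have "\<dots> = inv_deriv ((inv_deriv ^^ k) u) (inverse z)"
  proof (rule DERIV_imp_deriv)
    have "((inv_deriv ^^ k) u has_field_derivative deriv ((inv_deriv ^^ k) u) (inverse z))
        (at (inverse z))"
      using holomorphic_funpow_inv_deriv[OF hol opn] Suc.prems opn
      by (intro holomorphic_derivI)
    from DERIV_chain2[OF this DERIV_inverse[OF Suc.prems(1)]]
    show "((\<lambda>y. (inv_deriv ^^ k) u (inverse y)) has_field_derivative
        inv_deriv ((inv_deriv ^^ k) u) (inverse z)) (at z)"
      by (simp add: inv_deriv_def power2_eq_square mult.commute)
  qed
  finally show ?case
    by simp
qed (use w in simp)

section \<open>Logarithmic derivatives of polynomials at infinity\<close>

text \<open>
  For \<open>R\<close> the reflected polynomial, \<open>p(z) = z^degree p * R(1/z)\<close>, so \<open>z p'(z)/p(z)\<close> becomes the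
  function below at \<open>x = 1/z\<close>.
\<close>
definition root_sum :: "complex poly \<Rightarrow> complex \<Rightarrow> complex" where
  "root_sum p x = of_nat (degree p)
     - x * (poly (pderiv (reflect_poly p)) x / poly (reflect_poly p) x)"

text \<open>For nonzero \<open>p\<close> with roots r counted with multiplicity this is the sum of
  the series 1/(1 - r X), so its \<open>m\<close>-th coefficient is the sum of the
  \<open>m\<close>-th powers of the roots.\<close>

definition fps_root_sum :: "complex poly \<Rightarrow> complex fps" where
  "fps_root_sum p = fps_const (of_nat (degree p))
     - fps_X * (fps_deriv (fps_of_poly (reflect_poly p)) / fps_of_poly (reflect_poly p))"

lemma has_fps_expansion_fps_of_poly: "poly p has_fps_expansion fps_of_poly p"
  for p :: "complex poly"
  by (auto simp: has_fps_expansion_def eval_fps_of_poly fps_conv_radius_fps_of_poly)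

lemma has_fps_expansion_root_sum:
  assumes "p \<noteq> 0"
  shows "root_sum p has_fps_expansion fps_root_sum p"
  unfolding root_sum_def[abs_def] fps_root_sum_def fps_of_poly_pderiv[symmetric] using assms
  by (intro fps_expansion_intros has_fps_expansion_fps_of_poly) auto

lemma holomorphic_root_sum:
  assumes "\<And>x. x \<in> S \<Longrightarrow> poly (reflect_poly p) x \<noteq> 0"
  shows "root_sum p holomorphic_on S"
  unfolding root_sum_def[abs_def] using assms by (intro holomorphic_intros) auto

text \<open>Obtained by differentiating \<open>p(y) = y^d * R(1/y)\<close>, with \<open>d\<close>
  the degree and \<open>R\<close> the reflected polynomial, and comparing the two derivatives of
  \<open>p\<close> at \<open>z\<close>.\<close>

lemma poly_pderiv_quotient:
  assumes "z \<noteq> 0" "poly p z \<noteq> 0"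
  shows "poly (pderiv p) z / poly p z = inverse z * root_sum p (inverse z)"
proof -
  let ?R = "reflect_poly p" and ?d = "degree p"
  have eq: "poly p y = y ^ ?d * poly ?R (inverse y)" if "y \<noteq> 0" for y
    using that by (simp add: poly_reflect_poly_nz power_inverse)
  have R: "poly ?R (inverse z) \<noteq> 0"
    using assms eq by auto
  have D: "((\<lambda>y. y ^ ?d * poly ?R (inverse y)) has_field_derivative
      of_nat ?d * z ^ (?d - 1) * poly ?R (inverse z)
      + z ^ ?d * (poly (pderiv ?R) (inverse z) * - inverse (z ^ 2))) (at z)"
    using assms(1) by (auto intro!: derivative_eq_intros DERIV_chain2[OF poly_DERIV] simp: power2_eq_square)
  have "eventually (\<lambda>y. y \<in> - {0}) (nhds z)"
    using assms(1) by (intro eventually_nhds_in_open) auto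
  then have "eventually (\<lambda>y. poly p y = y ^ ?d * poly ?R (inverse y)) (nhds z)"
    by eventually_elim (use eq in auto)
  from DERIV_cong_ev[OF refl this refl] D
  have "(poly p has_field_derivative of_nat ?d * z ^ (?d - 1) * poly ?R (inverse z)
      + z ^ ?d * (poly (pderiv ?R) (inverse z) * - inverse (z ^ 2))) (at z)"
    by simp
  from DERIV_unique[OF poly_DERIV this]
  have "poly (pderiv p) z = of_nat ?d * z ^ (?d - 1) * poly ?R (inverse z)
      + z ^ ?d * (poly (pderiv ?R) (inverse z) * - inverse (z ^ 2))" .
  \<comment> \<open>For degree 0 the exponent \<open>?d - 1\<close> is truncated, but the factor
    \<open>of_nat ?d\<close> makes both sides vanish.\<close>
  moreover have "of_nat ?d * z ^ (?d - 1) = of_nat ?d * z ^ ?d * inverse z"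
    using assms(1) by (cases ?d) auto
  ultimately show ?thesis
    using assms(1) R unfolding eq[OF assms(1)] root_sum_def
    by (simp add: divide_simps power2_eq_square) (simp add: algebra_simps)
qed

lemma dlog_quotient:
  assumes "poly p z \<noteq> 0" "poly q z \<noteq> 0"
  shows "dlog (\<lambda>z. poly p z / poly q z) z
    = poly (pderiv p) z / poly p z - poly (pderiv q) z / poly q z"
proof -
  have "((\<lambda>z. poly p z / poly q z) has_field_derivative
      (poly (pderiv p) z * poly q z - poly p z * poly (pderiv q) z) / (poly q z * poly q z)) (at z)"
    using assms by (intro DERIV_divide poly_DERIV)
  then have "deriv (\<lambda>z. poly p z / poly q z) z
      = (poly (pderiv p) z * poly q z - poly p z * poly (pderiv q) z) / (poly q z * poly q z)"
    by (rule DERIV_imp_deriv)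
  then show ?thesis
    using assms by (simp add: dlog_def divide_simps)
qed

section \<open>From the differential equation to the formal equation\<close>

lemma expansion_at_infinity_dlog_quotient:
  assumes "p \<noteq> 0" "q \<noteq> 0"
    and sol: "P2_4_solution {z. poly p z \<noteq> 0 \<and> poly q z \<noteq> 0} \<alpha> (dlog (\<lambda>z. poly p z / poly q z))"
  shows "expansion_at_infinity \<alpha> (fps_nth (fps_root_sum p - fps_root_sum q))"
proof -
  define S where "S = {x. poly (reflect_poly p) x \<noteq> 0} \<inter> {x. poly (reflect_poly q) x \<noteq> 0}"
  define w where "w = dlog (\<lambda>z. poly p z / poly q z)"
  define u where "u = (\<lambda>x. x * (root_sum p x - root_sum q x))"
  define C where "C = fps_root_sum p - fps_root_sum q"
  define U where "U = fps_X * C"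
  have opn: "open S"
    unfolding S_def by (intro open_Int open_Collect_neq continuous_intros)
  \<comment> \<open>Reflected polynomials take the leading coefficients of \<open>p\<close> and
    \<open>q\<close> as values at 0.\<close>
  have zero: "0 \<in> S"
    using assms by (simp add: S_def)
  have hol: "u holomorphic_on S"
    unfolding u_def by (intro holomorphic_intros holomorphic_root_sum) (auto simp: S_def)
  have exp_u: "u has_fps_expansion U"
    unfolding u_def U_def C_def using assms
    by (intro fps_expansion_intros has_fps_expansion_root_sum)
  have nz: "poly p z \<noteq> 0 \<and> poly q z \<noteq> 0" if "z \<noteq> 0" "inverse z \<in> S" for z
    using that by (auto simp: S_def poly_reflect_poly_nz)
  have w: "w z = u (inverse z)" if "z \<noteq> 0" "inverse z \<in> S" for z
    using nz[OF that] that
    by (simp add: w_def u_def dlog_quotient poly_pderiv_quotient algebra_simps)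
  have D: "(deriv ^^ k) w z = (inv_deriv ^^ k) u (inverse z)" if "z \<noteq> 0" "inverse z \<in> S" for k z
    using funpow_deriv_inverse[OF hol opn w that] .
  define L where "L = (\<lambda>x. (inv_deriv ^^ 4) u x - 10 * (u x)^2 * (inv_deriv ^^ 2) u x
      - 10 * u x * ((inv_deriv ^^ 1) u x)^2 + 6 * (u x)^5)"
  \<comment> \<open>Multiplying by \<open>x\<close> clears the pole of z = 1/x: the identity becomes
    analytic at 0 and holds there too, as \<open>u 0 = 0\<close>.\<close>
  have eq: "x * L x - u x - x * \<alpha> = 0" if "x \<in> S" for x
  proof (cases "x = 0")
    case False
    define z where "z = inverse x"
    have z: "z \<noteq> 0" "inverse z \<in> S" "x = inverse z"
      using False that by (auto simp: z_def)
    have "(deriv ^^ 4) w z - 10 * (w z)^2 * (deriv ^^ 2) w z - 10 * w z * ((deriv ^^ 1) w z)^2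
        + 6 * (w z)^5 - z * w z - \<alpha> = 0"
      using sol nz[OF z(1,2)] unfolding P2_4_solution_def w_def by simp
    then have "L x - z * u x - \<alpha> = 0"
      by (simp add: D[OF z(1,2)] w[OF z(1,2)] L_def z(3) del: One_nat_def funpow.simps)
    then have "x * (L x - z * u x - \<alpha>) = 0"
      by simp
    then show ?thesis
      using False by (simp add: z_def right_diff_distrib flip: mult.assoc)
  qed (simp add: u_def)
  have "L has_fps_expansion fps_lower_terms U"
    unfolding L_def fps_lower_terms_def using has_fps_expansion_funpow_inv_deriv[OF exp_u, of 1]
    by (intro has_fps_expansion_add has_fps_expansion_diff has_fps_expansion_mult
        has_fps_expansion_power has_fps_expansion_numeral has_fps_expansion_funpow_inv_deriv exp_u)
       simp
  then have "(\<lambda>x. x * L x - u x - x * \<alpha>) has_fps_expansion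
      fps_X * fps_lower_terms U - U - fps_X * fps_const \<alpha>"
    by (intro fps_expansion_intros exp_u)
  moreover have "eventually (\<lambda>x. x * L x - u x - x * \<alpha> = 0) (nhds 0)"
    using eventually_nhds_in_open[OF opn zero] by eventually_elim (rule eq)
  ultimately have "(\<lambda>_. 0 :: complex) has_fps_expansion fps_X * fps_lower_terms U - U - fps_X * fps_const \<alpha>"
    using has_fps_expansion_cong[of "\<lambda>x. x * L x - u x - x * \<alpha>" "\<lambda>_. 0", OF _ refl] by blast
  then have "fps_X * fps_lower_terms U - U - fps_X * fps_const \<alpha> = 0"
    using fps_expansion_unique_complex has_fps_expansion_0 by blast
  \<comment> \<open>The extra factor from clearing the pole is cancelled again, formal power series
    over a field having no zero divisors.\<close>
  then have "fps_X * (fps_lower_terms U - C - fps_const \<alpha>) = 0"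
    by (simp add: U_def right_diff_distrib)
  then have "fps_lower_terms U - C - fps_const \<alpha> = 0"
    by (simp only: mult_eq_0_iff fps_X_neq_zero simp_thms)
  then have "C = fps_lower_terms U - fps_const \<alpha>"
    by (metis diff_eq_eq add.commute eq_iff_diff_eq_0)
  then show ?thesis
    unfolding expansion_at_infinity_iff fps_nth_inverse C_def[symmetric] U_def[symmetric] .
qed

section \<open>Newton's identities\<close>

text \<open>Each step refers only to smaller indices, since \<open>l\<close> starts at 1. The bound
  \<open>M\<close> allows the recurrence to be assumed only up to the degree, beyond which
  \<open>degree p - m\<close> is truncated.\<close>

lemma newton_coeff_unique:
  assumes "a 0 = 1"
    and "\<And>m. m < M \<Longrightarrow> of_nat (Suc m) * a (Suc m) = - (\<Sum>l\<in>{1..Suc m}. s l * a (Suc m - l))"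
    and "m \<le> M"
  shows "a m = newton_coeff s m"
  using \<open>m \<le> M\<close>
proof (induction m rule: less_induct)
  case (less m)
  show ?case
  proof (cases m)
    case (Suc k)
    have "(\<Sum>l\<in>{1..Suc k}. s l * a (Suc k - l)) = (\<Sum>l\<in>{1..Suc k}. s l * newton_coeff s (Suc k - l))"
      using less Suc by (intro sum.cong) auto
    with assms(2)[of k] less.prems Suc
    have "of_nat (Suc k) * a m = - (\<Sum>l\<in>{1..Suc k}. s l * newton_coeff s (Suc k - l))"
      by (simp only:)
    then show ?thesis
      unfolding Suc newton_coeff.simps by (metis nonzero_mult_div_cancel_left of_nat_neq_0)
  qed (use assms in simp)
qed

text \<open>Compare coefficients in \<open>s * R = d * R - X * R'\<close>, where \<open>s\<close> is
  the root sum series, \<open>d\<close> the degree and \<open>R\<close> the reflected polynomial,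
  which lists the coefficients of \<open>p\<close> from the top.\<close>

lemma fps_root_sum_newton:
  assumes "p \<noteq> 0"
  shows "fps_root_sum p $ 0 = of_nat (degree p)"
    and "m < degree p \<Longrightarrow> of_nat (Suc m) * coeff p (degree p - Suc m)
      = - (\<Sum>l\<in>{1..Suc m}. fps_root_sum p $ l * coeff p (degree p - (Suc m - l)))"
proof -
  let ?R = "fps_of_poly (reflect_poly p)" and ?s = "fps_root_sum p"
  show s0: "?s $ 0 = of_nat (degree p)"
    by (simp add: fps_root_sum_def)
  have "?R $ 0 \<noteq> 0"
    using assms by simp
  then have "?s * ?R = fps_const (of_nat (degree p)) * ?R - fps_X * fps_deriv ?R"
    by (simp add: fps_root_sum_def left_diff_distrib fps_divide_unit mult.assoc inverse_mult_eq_1)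
  then have "(?s * ?R) $ Suc m
      = (fps_const (of_nat (degree p)) * ?R - fps_X * fps_deriv ?R) $ Suc m"
    by (simp only:)
  also have "\<dots> = (of_nat (degree p) - of_nat (Suc m)) * ?R $ Suc m"
    by (simp add: algebra_simps)
  finally have "(\<Sum>l=0..Suc m. ?s $ l * ?R $ (Suc m - l))
      = (of_nat (degree p) - of_nat (Suc m)) * ?R $ Suc m"
    by (simp only: fps_mult_nth)
  \<comment> \<open>The term \<open>l = 0\<close> is split off; as \<open>?s $ 0\<close> is the
    degree, it cancels the degree term on the right.\<close>
  then have *: "of_nat (Suc m) * ?R $ Suc m = - (\<Sum>l\<in>{1..Suc m}. ?s $ l * ?R $ (Suc m - l))"
    unfolding sum.atLeast_Suc_atMost[OF le0] eq_neg_iff_add_eq_0 by (simp add: s0 algebra_simps)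
  assume "m < degree p"
  then have R: "?R $ l = coeff p (degree p - l)" if "l \<le> Suc m" for l
    using that by (simp add: coeff_reflect_poly)
  then have "(\<Sum>l\<in>{1..Suc m}. ?s $ l * ?R $ (Suc m - l))
      = (\<Sum>l\<in>{1..Suc m}. ?s $ l * coeff p (degree p - (Suc m - l)))"
    by (intro sum.cong) auto
  then show "of_nat (Suc m) * coeff p (degree p - Suc m)
      = - (\<Sum>l\<in>{1..Suc m}. ?s $ l * coeff p (degree p - (Suc m - l)))"
    using * R[OF order_refl] by (simp only:)
qed

section \<open>Telescoping and recovery of the coefficients\<close>

theorem theorem5p2:
  fixes Q :: "nat \<Rightarrow> complex poly"
    and c :: "complex \<Rightarrow> nat \<Rightarrow> complex"
  assumes deg: "\<And>n. degree (Q n) = n * (n + 1) div 2"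
    and monic: "\<And>n. lead_coeff (Q n) = 1"
    and sol: "\<And>n. n \<ge> 1 \<Longrightarrow>
      P2_4_solution {z. poly (Q (n - 1)) z \<noteq> 0 \<and> poly (Q n) z \<noteq> 0} (of_nat n) (rational_w Q n)"
    and expansion: "\<And>\<alpha>. expansion_at_infinity \<alpha> (c \<alpha>)"
  shows "\<forall>n. \<forall>d :: nat \<Rightarrow> nat \<Rightarrow> complex.
      (\<forall>i\<in>{1..n}. \<forall>m < n * (n + 1) div 2 + 1. d i m = c (of_nat i) m) \<longrightarrow>
        of_nat (degree (Q n)) = power_sum_of d n 0 \<and>
        (\<forall>m \<le> n * (n + 1) div 2.
           coeff (Q n) (n * (n + 1) div 2 - m) = newton_coeff (power_sum_of d n) m)"
proof (intro allI impI)
  fix n :: nat and d :: "nat \<Rightarrow> nat \<Rightarrow> complex"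
  assume d: "\<forall>i\<in>{1..n}. \<forall>m < n * (n + 1) div 2 + 1. d i m = c (of_nat i) m"
  have nz: "Q k \<noteq> 0" for k
    using monic[of k] by auto
  have c: "c (of_nat i) = fps_nth (fps_root_sum (Q (i - 1)) - fps_root_sum (Q i))" if "i \<ge> 1" for i
    using expansion_at_infinity_dlog_quotient[OF nz nz sol[OF that, unfolded rational_w_def]]
    by (rule expansion_at_infinity_unique[OF expansion])
  have "degree (Q 0) = 0"
    by (simp add: deg)
  \<comment> \<open>\<open>Q 0\<close> is constant and has no roots, so the telescoping sum leaves
    only the term of \<open>Q k\<close>.\<close>
  then have "fps_root_sum (Q 0) = 0"
    by (auto elim!: degree_eq_zeroE simp: fps_root_sum_def fps_of_poly_pCons)
  then have "(\<Sum>i=1..k. c (of_nat i) m) = - fps_root_sum (Q k) $ m" for k m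
    by (induction k) (simp_all add: c)
  \<comment> \<open>The indices from 0 to \<open>degree (Q n)\<close> are exactly the
    \<open>n * (n + 1) div 2 + 1\<close> places where \<open>d\<close> is known to agree with
    \<open>c\<close>.\<close>
  moreover have "power_sum_of d n m = - (\<Sum>i=1..n. c (of_nat i) m)" if "m \<le> degree (Q n)" for m
    unfolding power_sum_of_def using d that by (auto simp: deg intro!: sum.cong)
  ultimately have s: "power_sum_of d n m = fps_root_sum (Q n) $ m" if "m \<le> degree (Q n)" for m
    using that by simp
  have "coeff (Q n) (degree (Q n) - m) = newton_coeff (power_sum_of d n) m" if "m \<le> degree (Q n)" for m
  proof (rule newton_coeff_unique[where a = "\<lambda>m. coeff (Q n) (degree (Q n) - m)", OF _ _ that])
    show "coeff (Q n) (degree (Q n) - 0) = 1"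
      using monic by simp
    fix m assume m: "m < degree (Q n)"
    then show "of_nat (Suc m) * coeff (Q n) (degree (Q n) - Suc m)
        = - (\<Sum>l\<in>{1..Suc m}. power_sum_of d n l * coeff (Q n) (degree (Q n) - (Suc m - l)))"
      using s by (subst fps_root_sum_newton(2)[OF nz m]) simp
  qed
  then show "of_nat (degree (Q n)) = power_sum_of d n 0 \<and>
        (\<forall>m \<le> n * (n + 1) div 2.
           coeff (Q n) (n * (n + 1) div 2 - m) = newton_coeff (power_sum_of d n) m)"
    unfolding deg[symmetric] using s[of 0] fps_root_sum_newton(1)[OF nz] by simp
qed

end
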